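(* Let $\sigma$ satisfy $\log \sigma = \Omega(\log \log n)$. Any encoding data structure that indexes an arbitrary string $S[1..n]$ over the alphabet $[\sigma] = \{1,\ldots,\sigma\}$ and which, given any pattern $P[1..m]$ with $m = \lg n$, establishes whether $P$ has at least one order-preserving occurrence in $S$, must use $\Omega(n \log \log n)$ bits of space (in the worst case over strings $S$).
   Context: For a sequence $X[1..k]$ over a totally ordered alphabet, the rank encoding $E(X)[1..k]$ is defined by: $E(X)[i] = 0.5$ if $X[i]$ is smaller than every element of $T_i = \{X[1],\ldots,X[i-1]\}$; $E(X)[i] = j$ if $X[i]$ equals the $j$th smallest element of $T_i$; $E(X)[i] = j+0.5$ if $X[i]$ lies strictly between the $j$th and $(j+1)$st smallest elements of $T_i$; $E(X)[i] = |T_i| + 0.5$ if $X[i]$ is larger than every element of $T_i$. $P[1..m]$ has an order-preserving occurrence in $S$ iff there is a position $i$ with $E(S[i..i+m-1]) = E(P)$. *)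

theory Defs
  imports Complex_Main "HOL-Library.Landau_Symbols"
begin

text \<open>The \<open>j\<close>-th smallest element of a finite set, \<open>1 \<le> j \<le> card T\<close>.\<close>

definition kth_smallest :: "'a::linorder set \<Rightarrow> nat \<Rightarrow> 'a" where
  "kth_smallest T j = sorted_list_of_set T ! (j - 1)"

definition rank_code :: "'a::linorder set \<Rightarrow> 'a \<Rightarrow> real" where
  "rank_code T x =
    (if \<forall>y\<in>T. x < y then 1/2
     else if x \<in> T then
       real (THE j. 1 \<le> j \<and> j \<le> card T \<and> x = kth_smallest T j)
     else if \<forall>y\<in>T. y < x then real (card T) + 1/2
     else
       real (THE j. 1 \<le> j \<and> j < card T \<and> kth_smallest T j < x \<and> x < kth_smallest T (j + 1)) + 1/2)"

text \<open>Lists are indexed from \<open>0\<close>, so \<open>take i X\<close> is the prefix strictly before entry \<open>X ! i\<close>.\<close>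

definition rank_encoding :: "'a::linorder list \<Rightarrow> real list" where
  "rank_encoding X = map (\<lambda>i. rank_code (set (take i X)) (X ! i)) [0..<length X]"

definition op_occurs :: "'a::linorder list \<Rightarrow> 'a list \<Rightarrow> bool" where
  "op_occurs P S \<longleftrightarrow>
    (\<exists>i. i + length P \<le> length S \<and>
         rank_encoding (take (length P) (drop i S)) = rank_encoding P)"

definition strings :: "nat \<Rightarrow> nat \<Rightarrow> nat list set" where
  "strings n \<sigma> = {S. length S = n \<and> set S \<subseteq> {1..\<sigma>}}"

text \<open>
  An encoding data structure maps each string to a bit string; queries are answered from the bit
  string and the pattern alone, without access to the indexed string. No restriction is placed on
  the computational power of either function.
\<close>

definition encoding_data_structure ::
  "nat \<Rightarrow> nat \<Rightarrow> nat \<Rightarrow> (nat list \<Rightarrow> bool list) \<Rightarrow> (bool list \<Rightarrow> nat list \<Rightarrow> bool) \<Rightarrow> bool" where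
  "encoding_data_structure n \<sigma> m enc query \<longleftrightarrow>
    (\<forall>S \<in> strings n \<sigma>. \<forall>P \<in> strings m \<sigma>. query (enc S) P \<longleftrightarrow> op_occurs P S)"

definition worst_case_bits :: "nat \<Rightarrow> nat \<Rightarrow> (nat list \<Rightarrow> bool list) \<Rightarrow> nat" where
  "worst_case_bits n \<sigma> enc = (SUP S \<in> strings n \<sigma>. length (enc S))"

end

theory Submission
  imports Defs "HOL-Real_Asymp.Real_Asymp"
begin

text \<open>
  Let \<open>D\<close> be a set of patterns of length \<open>m\<close> with pairwise distinct rank encodings, and concatenate
  \<open>k = n div m\<close> of them to a string of length \<open>n\<close>. The answers to all queries reveal at most \<open>n\<close>
  elements of \<open>D\<close> that occur in the string, since it has at most \<open>n\<close> windows, and all \<open>k\<close> blocks are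
  among these. So each bit string encodes at most \<open>n ^ k\<close> of the \<open>card D ^ k\<close> concatenations, which
  forces about \<open>k * (log 2 (card D) - log 2 n)\<close> bits; in particular, occurrences that straddle
  blocks need no attention. With \<open>s = min \<sigma> (m div 2)\<close>, the patterns that start with \<open>1, \<dots>, s\<close> and
  continue arbitrarily over \<open>{1..s}\<close> give \<open>card D = s ^ (m - s)\<close>, and \<open>log 2 s\<close> has order \<open>log 2 m\<close>.
\<close>

section \<open>Patterns with pairwise distinct rank encodings\<close>

text \<open>In \<open>{1..s}\<close> the \<open>j\<close>-th smallest element is \<open>j\<close>
  itself, so a symbol can be read off its code.\<close>

lemma rank_code_atLeastAtMost:
  assumes "x \<in> {1..s}"
  shows "rank_code {1..s} x = real x"
proof -
  have kth: "kth_smallest {1..s} j = j" if "1 \<le> j" "j \<le> s" for j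
  proof -
    have "sorted_list_of_set {1..s} = [1..<Suc s]"
      by (metis atLeastLessThanSuc_atLeastAtMost sorted_list_of_set_range)
    then show ?thesis
      using that by (simp add: kth_smallest_def del: upt_Suc)
  qed
  have "(THE j. 1 \<le> j \<and> j \<le> card {1..s} \<and> x = kth_smallest {1..s} j) = x"
    by (rule the_equality) (use assms kth in auto)
  moreover have "\<not> (\<forall>y\<in>{1..s}. x < y)"
    using assms by blast
  ultimately show ?thesis
    using assms unfolding rank_code_def by simp
qed

text \<open>After the prefix \<open>1, ..., s\<close> the set of earlier entries stays
  \<open>{1..s}\<close>, so each later code is the entry itself.\<close>

lemma inj_on_rank_encoding_upt_append:
  "inj_on rank_encoding ((@) [1..<Suc s] ` {ys. set ys \<subseteq> {1..s} \<and> length ys = l})"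
proof (rule inj_onI)
  have nth: "rank_encoding ([1..<Suc s] @ ys) ! (s + i) = real (ys ! i)"
    if "set ys \<subseteq> {1..s}" "i < length ys" for ys i
  proof -
    have "set (take (s + i) ([1..<Suc s] @ ys)) = {1..s}"
      using that set_take_subset[of i ys] by (auto simp del: upt_Suc)
    moreover have "([1..<Suc s] @ ys) ! (s + i) = ys ! i"
      by (simp add: nth_append del: upt_Suc)
    moreover have "ys ! i \<in> {1..s}"
      using that nth_mem by blast
    ultimately show ?thesis
      using that rank_code_atLeastAtMost[of "ys ! i" s]
      by (simp add: rank_encoding_def del: upt_Suc)
  qed
  fix X Y
  assume "X \<in> (@) [1..<Suc s] ` {ys. set ys \<subseteq> {1..s} \<and> length ys = l}"
    and "Y \<in> (@) [1..<Suc s] ` {ys. set ys \<subseteq> {1..s} \<and> length ys = l}"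
    and eq: "rank_encoding X = rank_encoding Y"
  then obtain xs ys where
    X: "X = [1..<Suc s] @ xs" "set xs \<subseteq> {1..s}" "length xs = l" and
    Y: "Y = [1..<Suc s] @ ys" "set ys \<subseteq> {1..s}" "length ys = l"
    by blast
  have "xs ! i = ys ! i" if "i < l" for i
    using nth[of xs i] nth[of ys i] eq X Y that by simp
  then have "xs = ys"
    using X Y by (simp add: nth_equalityI)
  then show "X = Y"
    using X Y by simp
qed

text \<open>Spending \<open>s\<close> entries on the prefix makes the other \<open>m - s\<close>
  recoverable; \<open>s\<close> stays free so that the two can be balanced later.\<close>

lemma exists_order_distinct_patterns:
  assumes "s \<le> \<sigma>" "s \<le> m"
  shows "\<exists>D \<subseteq> strings m \<sigma>. inj_on rank_encoding D \<and> card D = s ^ (m - s)"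
proof (intro exI conjI)
  let ?Y = "{ys. set ys \<subseteq> {1..s} \<and> length ys = m - s}"
  show "(@) [1..<Suc s] ` ?Y \<subseteq> strings m \<sigma>"
    using assms by (fastforce simp: strings_def simp del: upt_Suc)
  show "inj_on rank_encoding ((@) [1..<Suc s] ` ?Y)"
    by (rule inj_on_rank_encoding_upt_append)
  show "card ((@) [1..<Suc s] ` ?Y) = s ^ (m - s)"
    by (subst card_image) (simp_all add: inj_on_def card_lists_length_eq)
qed

section \<open>Counting strings against bit strings\<close>

lemma finite_strings: "finite (strings n \<sigma>)"
  using finite_lists_length_eq[of "{1..\<sigma>}" n] by (simp add: strings_def conj_commute)

text \<open>No window matches two patterns of \<open>D\<close>, as their encodings differ; so the
  number of windows bounds the count.\<close>

lemma card_occurring_patterns_le: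
  assumes "\<And>P. P \<in> D \<Longrightarrow> length P = m" "inj_on rank_encoding D"
  shows "card {P \<in> D. op_occurs P S} \<le> Suc (length S - m)"
proof -
  let ?W = "(\<lambda>i. rank_encoding (take m (drop i S))) ` {..length S - m}"
  have "rank_encoding ` {P \<in> D. op_occurs P S} \<subseteq> ?W"
  proof (rule image_subsetI)
    fix P
    assume "P \<in> {P \<in> D. op_occurs P S}"
    then obtain i where "i + m \<le> length S" "rank_encoding (take m (drop i S)) = rank_encoding P"
      using assms(1) by (auto simp: op_occurs_def)
    then show "rank_encoding P \<in> ?W"
      by (intro image_eqI[of _ _ i]) auto
  qed
  then have "card (rank_encoding ` {P \<in> D. op_occurs P S}) \<le> card ?W"
    by (intro card_mono) auto
  also have "\<dots> \<le> Suc (length S - m)"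
    using card_image_le[of "{..length S - m}"] by simp
  finally show ?thesis
    using card_image[OF inj_on_subset[OF assms(2)], of "{P \<in> D. op_occurs P S}"] by simp
qed

lemma op_occurs_append: "op_occurs P (xs @ P @ ys)"
  unfolding op_occurs_def by (rule exI[of _ "length xs"]) simp

lemma card_bool_lists_length_le: "card {b :: bool list. length b \<le> B} \<le> 2 ^ Suc B"
proof -
  have "card {b :: bool list. length b \<le> B} = (\<Sum>i\<le>B. 2 ^ i)"
    using card_lists_length_le[of "UNIV :: bool set" B] by simp
  also have "\<dots> = 2 ^ Suc B - (1 :: nat)"
    by (induction B) auto
  finally show ?thesis
    by simp
qed

text \<open>Codes may have any length up to the worst case, whence the \<open>Suc\<close>. The
  supremum is over a finite set, so it bounds every code length.\<close>

lemma card_encodings_le: "card (enc ` strings n \<sigma>) \<le> 2 ^ Suc (worst_case_bits n \<sigma> enc)"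
proof -
  have "length (enc S) \<le> worst_case_bits n \<sigma> enc" if "S \<in> strings n \<sigma>" for S
    unfolding worst_case_bits_def
    by (rule cSUP_upper) (use that finite_strings in auto)
  then have "enc ` strings n \<sigma> \<subseteq> {b. length b \<le> worst_case_bits n \<sigma> enc}"
    by auto
  moreover have "finite {b :: bool list. length b \<le> worst_case_bits n \<sigma> enc}"
    using finite_lists_length_le[of "UNIV :: bool set"] by simp
  ultimately show ?thesis
    by (rule order_trans[OF card_mono card_bool_lists_length_le, rotated])
qed

text \<open>A bit string \<open>b\<close> need not determine the concatenation. It does determine
  the set \<open>Q b\<close> that contains all blocks, which leaves at most \<open>n\<close> choices
  per block.\<close>

lemma card_patterns_power_le:
  assumes eds: "encoding_data_structure n \<sigma> m enc query"
    and D: "D \<subseteq> strings m \<sigma>" "inj_on rank_encoding D"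
    and k: "k * m \<le> n" and m: "1 \<le> m" "m \<le> n" and \<sigma>: "1 \<le> \<sigma>"
  shows "card D ^ k \<le> 2 ^ Suc (worst_case_bits n \<sigma> enc) * n ^ k"
proof -
  let ?L = "\<lambda>A. {w. set w \<subseteq> A \<and> length w = k}"
  define Q where "Q b = {P \<in> D. query b P}" for b
  \<comment> \<open>Padding reaches length exactly \<open>n\<close>; occurrences that it creates are
    covered by the window count.\<close>
  define str where "str w = concat w @ replicate (n - k * m) 1" for w :: "nat list list"
  have finD: "finite D"
    using D finite_strings finite_subset by blast
  then have finQ: "finite (Q b)" for b
    by (simp add: Q_def)
  have Q_enc: "Q (enc S) = {P \<in> D. op_occurs P S}" if "S \<in> strings n \<sigma>" for S
    using eds D that unfolding Q_def encoding_data_structure_def by blast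
  have str: "str w \<in> strings n \<sigma>" if "w \<in> ?L D" for w
  proof -
    have blocks: "length P = m \<and> set P \<subseteq> {1..\<sigma>}" if "P \<in> set w" for P
      using D \<open>w \<in> ?L D\<close> that by (auto simp: strings_def)
    then have "map length w = replicate k m"
      using \<open>w \<in> ?L D\<close> by (auto intro: nth_equalityI)
    then have "length (concat w) = k * m"
      by (simp add: length_concat sum_list_replicate)
    moreover have "set (concat w) \<subseteq> {1..\<sigma>}"
      using blocks by auto
    ultimately show ?thesis
      using k \<sigma> by (auto simp: str_def strings_def)
  qed
  have "w \<in> ?L (Q (enc (str w)))" if w: "w \<in> ?L D" for w
  proof -
    have "op_occurs P (str w)" if "P \<in> set w" for P
    proof -
      obtain us vs where "w = us @ P # vs"
        using \<open>P \<in> set w\<close> by (meson split_list)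
      then show ?thesis
        using op_occurs_append[of P "concat us"] by (simp add: str_def)
    qed
    then show ?thesis
      using w Q_enc[OF str[OF w]] by auto
  qed
  \<comment> \<open>The union runs over codes, not strings: all strings with the same code share one
    \<open>Q b\<close>.\<close>
  then have "?L D \<subseteq> (\<Union>b \<in> enc ` strings n \<sigma>. ?L (Q b))"
    using str by blast
  then have "card (?L D) \<le> card (\<Union>b \<in> enc ` strings n \<sigma>. ?L (Q b))"
    by (intro card_mono) (auto simp: finite_strings finite_lists_length_eq finQ)
  also have "\<dots> \<le> (\<Sum>b \<in> enc ` strings n \<sigma>. card (?L (Q b)))"
    by (intro card_UN_le finite_imageI finite_strings)
  also have "\<dots> \<le> (\<Sum>b \<in> enc ` strings n \<sigma>. n ^ k)"
  proof (rule sum_mono)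
    fix b
    assume "b \<in> enc ` strings n \<sigma>"
    then obtain S where S: "S \<in> strings n \<sigma>" "b = enc S"
      by blast
    have "card (Q b) \<le> Suc (length S - m)"
      unfolding S Q_enc[OF S(1)]
      by (rule card_occurring_patterns_le) (use D in \<open>auto simp: strings_def\<close>)
    \<comment> \<open>The \<open>n - m + 1\<close> windows number at most \<open>n\<close> because
      \<open>1 \<le> m\<close>.\<close>
    also have "\<dots> \<le> n"
      using S m by (simp add: strings_def)
    finally show "card (?L (Q b)) \<le> n ^ k"
      by (simp add: card_lists_length_eq finQ power_mono)
  qed
  also have "\<dots> \<le> 2 ^ Suc (worst_case_bits n \<sigma> enc) * n ^ k"
    unfolding sum_constant of_nat_id by (intro mult_right_mono card_encodings_le) auto
  finally show ?thesis
    by (simp add: card_lists_length_eq finD)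
qed

text \<open>This is the logarithm of the counting bound for \<open>n div m\<close> blocks: a block
  carries \<open>(m - s) * log 2 s\<close> bits, of which the code can leave at most
  \<open>log 2 n\<close> open.\<close>

lemma worst_case_bits_ge:
  assumes eds: "encoding_data_structure n \<sigma> m enc query"
    and m: "1 \<le> m" "m \<le> n" and s: "1 \<le> s" "s \<le> \<sigma>" "s \<le> m"
  shows "real (n div m) * (real (m - s) * log 2 s - log 2 n)
    \<le> real (worst_case_bits n \<sigma> enc) + 1"
proof -
  let ?k = "n div m" and ?B = "worst_case_bits n \<sigma> enc"
  obtain D where D: "D \<subseteq> strings m \<sigma>" "inj_on rank_encoding D" "card D = s ^ (m - s)"
    using exists_order_distinct_patterns[OF s(2,3)] by blast
  have "(s ^ (m - s)) ^ ?k \<le> 2 ^ Suc ?B * n ^ ?k"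
    using card_patterns_power_le[OF eds D(1,2), of ?k] D(3) m s by simp
  then have "real ((s ^ (m - s)) ^ ?k) \<le> real (2 ^ Suc ?B * n ^ ?k)"
    by (rule of_nat_mono)
  then have le: "(real s ^ (m - s)) ^ ?k \<le> 2 ^ Suc ?B * real n ^ ?k"
    by simp
  have "log 2 ((real s ^ (m - s)) ^ ?k) \<le> log 2 (2 ^ Suc ?B * real n ^ ?k)"
    by (subst log_le_cancel_iff) (use m s le in auto)
  also have "\<dots> = real (Suc ?B) + real ?k * log 2 n"
    using m by (subst log_mult) (simp_all add: log_nat_power del: power_Suc)
  finally show ?thesis
    using s by (simp add: log_nat_power algebra_simps)
qed

section \<open>Choice of parameters and asymptotics\<close>

lemma real_div_minus_one_le: "real n / real d - 1 \<le> real (n div d)"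
proof -
  have "real n / real d = real (n div d) + real (n mod d) / real d"
    by (rule of_nat_of_nat_div_aux)
  moreover have "real (n mod d) / real d \<le> 1"
    by (cases "d = 0") (simp_all add: less_imp_le)
  ultimately show ?thesis
    by simp
qed

theorem theorem10:
  fixes \<sigma> m :: "nat \<Rightarrow> nat"
    and enc :: "nat \<Rightarrow> nat list \<Rightarrow> bool list"
    and query :: "nat \<Rightarrow> bool list \<Rightarrow> nat list \<Rightarrow> bool"
  assumes "(\<lambda>n. log 2 (real (\<sigma> n))) \<in> \<Omega>(\<lambda>n. log 2 (log 2 (real n)))"
    and "\<And>n. n \<ge> 1 \<Longrightarrow> int (m n) = \<lfloor>log 2 (real n)\<rfloor> \<or> int (m n) = \<lceil>log 2 (real n)\<rceil>"
    and "\<And>n. n \<ge> 1 \<Longrightarrow> encoding_data_structure n (\<sigma> n) (m n) (enc n) (query n)"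
  shows "(\<lambda>n. real (worst_case_bits n (\<sigma> n) (enc n))) \<in> \<Omega>(\<lambda>n. real n * log 2 (log 2 (real n)))"
proof -
  obtain c where c: "c > 0"
    and ev_\<sigma>: "\<forall>\<^sub>F n in at_top. norm (log 2 (real (\<sigma> n))) \<ge> c * norm (log 2 (log 2 (real n)))"
    using landau_omega.bigE[OF assms(1)] by blast
  \<comment> \<open>The constant \<open>c\<close> serves the case \<open>s = \<sigma> n\<close>;
    \<open>1/2\<close> serves \<open>s = m n div 2\<close>, which is at least the square root of
    \<open>log 2 n\<close>.\<close>
  define d where "d = min c (1/2)"
  have d: "d > 0" "d \<le> c" "d \<le> 1/2"
    using c by (auto simp: d_def)
  have "\<forall>\<^sub>F n :: nat in at_top. 8 \<le> d * log 2 (log 2 (real n))"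
    using d by real_asymp
  moreover have "\<forall>\<^sub>F n :: nat in at_top. 2 * (log 2 (real n) + 1) \<le> real n"
    by real_asymp
  moreover have "\<forall>\<^sub>F n :: nat in at_top. log 2 (real n) powr (1/2) \<le> (log 2 (real n) - 2) / 2"
    by real_asymp
  \<comment> \<open>In \<open>d / 16\<close>, a factor 2 is lost by rounding
    \<open>n div m n\<close>, a factor 4 inside each block, and a factor 2 to absorb the additive
    1.\<close>
  ultimately have
    "\<forall>\<^sub>F n in at_top. norm (real (worst_case_bits n (\<sigma> n) (enc n)))
      \<ge> d / 16 * norm (real n * log 2 (log 2 (real n)))"
    using ev_\<sigma> eventually_ge_at_top[of 16]
  proof eventually_elim
    case (elim n)
    define L where "L = log 2 (real n)"
    define l where "l = log 2 L"
    \<comment> \<open>The symbols must fit the alphabet, and at least half of the pattern must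
      remain free.\<close>
    define s where "s = min (\<sigma> n) (m n div 2)"
    have l8: "8 \<le> d * l" and nL: "2 * (L + 1) \<le> real n" and sqrtL: "L powr (1/2) \<le> (L - 2) / 2"
      and \<sigma>_ge: "c * \<bar>l\<bar> \<le> \<bar>log 2 (real (\<sigma> n))\<bar>" and n: "16 \<le> n"
      using elim by (simp_all add: L_def l_def)
    have L4: "4 \<le> L"
    proof -
      have "log 2 (2 ^ 4) \<le> log 2 (real n)"
        using n by (subst log_le_cancel_iff) auto
      then show ?thesis
        unfolding L_def by (subst (asm) log_nat_power) auto
    qed
    have l: "l > 0"
      using l8 d by (smt (verit) mult_nonneg_nonpos)
    have mL: "L - 1 \<le> real (m n)" "real (m n) \<le> L + 1"
      using assms(2)[of n] n unfolding L_def by linarith+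
    have m: "1 \<le> m n" "2 * real (m n) \<le> real n"
      using mL nL L4 by (simp_all add: field_simps)
    have "0 < \<bar>log 2 (real (\<sigma> n))\<bar>"
      using \<sigma>_ge c l by (smt (verit) mult_pos_pos)
    \<comment> \<open>An empty alphabet is excluded because \<open>log 2 0 = 0\<close> by
      convention.\<close>
    then have \<sigma>: "1 \<le> \<sigma> n"
      by (cases "\<sigma> n") (auto simp: log_def)
    have half: "(L - 2) / 2 \<le> real (m n div 2)"
      using mL real_div_minus_one_le[of "m n" 2] by simp
    have "1 \<le> (L - 2) / 2"
      using L4 by simp
    then have "1 \<le> m n div 2"
      using half by linarith
    then have s: "1 \<le> s" "s \<le> \<sigma> n" "2 * s \<le> m n"
      using \<sigma> by (auto simp: s_def)
    have log_s: "d * l \<le> log 2 s"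
    proof (cases "\<sigma> n \<le> m n div 2")
      case True
      have "d * l \<le> c * \<bar>l\<bar>"
        using d l by (simp add: mult_right_mono)
      also have "\<dots> \<le> log 2 (real (\<sigma> n))"
        using \<sigma>_ge \<sigma> by simp
      finally show ?thesis
        using True by (simp add: s_def)
    next
      case False
      have "d * l \<le> 1/2 * l"
        using d l by (intro mult_right_mono) auto
      also have "\<dots> = log 2 (L powr (1/2))"
        using L4 by (simp add: l_def log_powr)
      also have "\<dots> \<le> log 2 (real (m n div 2))"
        using sqrtL half L4 by (subst log_le_cancel_iff) auto
      finally show ?thesis
        using False by (simp add: s_def)
    qed
    have div: "real n / (2 * real (m n)) \<le> real (n div m n)"
    proof -
      \<comment> \<open>Since \<open>n / m n\<close> is at least 2, rounding it down costs at most
        half.\<close>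
      have "real n / (2 * real (m n)) \<ge> 1"
        using m by (simp add: field_simps)
      then show ?thesis
        using real_div_minus_one_le[of n "m n"] by simp
    qed
    \<comment> \<open>The free half gives \<open>m n * (d * l) / 2\<close>; the loss
      \<open>L\<close> is at most \<open>2 * m n\<close>, hence at most half of this by
      \<open>8 \<le> d * l\<close>.\<close>
    have content: "real (m n) * (d * l) / 4 \<le> real (m n - s) * log 2 s - L"
    proof -
      have "real (m n) / 2 * (d * l) \<le> real (m n - s) * log 2 s"
        using s log_s l8 by (intro mult_mono) auto
      then have "real (m n) * (d * l) / 2 \<le> real (m n - s) * log 2 s"
        by simp
      moreover have "real (m n) * 8 \<le> real (m n) * (d * l)"
        using l8 by (intro mult_left_mono) auto
      moreover have "L \<le> real (m n) * 8 / 4"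
        using mL L4 by simp
      ultimately show ?thesis
        by linarith
    qed
    have "real n * (d * l) / 8 = real n / (2 * real (m n)) * (real (m n) * (d * l) / 4)"
      using m by (simp add: field_simps)
    also have "\<dots> \<le> real (n div m n) * (real (m n - s) * log 2 s - L)"
      using div content l8 by (intro mult_mono) auto
    also have "\<dots> \<le> real (worst_case_bits n (\<sigma> n) (enc n)) + 1"
      unfolding L_def using assms(3)[of n] m n s by (intro worst_case_bits_ge) auto
    finally have "real n * (d * l) / 8 \<le> real (worst_case_bits n (\<sigma> n) (enc n)) + 1" .
    moreover have "16 * 8 \<le> real n * (d * l)"
      using n l8 by (intro mult_mono) auto
    ultimately have "real n * (d * l) / 16 \<le> real (worst_case_bits n (\<sigma> n) (enc n))"
      by linarith
    then show ?case
      using l by (simp add: abs_mult l_def L_def mult_ac)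
  qed
  then show ?thesis
    using d by (intro landau_omega.bigI[of "d / 16"]) auto
qed

end
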